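(* The theory $Q^\backsim$ strengthens $R^\backsim$ in the first-order logic $\mathrm{QSL}_w$, i.e. $Q^\backsim\vdash_{\mathrm{QSL}_w}\varphi$ for every axiom $\varphi$ of $R^\backsim$.
   Context: Propositional logic $\mathrm{SL}_w$ in the language $\to,\wedge,\vee,\bot$ (with $\neg\varphi:=\varphi\to\bot$, $\varphi\leftrightarrow\psi:=(\varphi\to\psi)\wedge(\psi\to\varphi)$), given by axioms: $\varphi\to\varphi$; $(\varphi\wedge\psi)\to\varphi$; $(\varphi\wedge\psi)\to\psi$; $((\varphi\to\psi)\wedge(\varphi\to\chi))\to(\varphi\to\psi\wedge\chi)$; $\varphi\to(\varphi\vee\psi)$; $\psi\to(\varphi\vee\psi)$; $(\varphi\to\chi)\wedge(\psi\to\chi)\to(\varphi\vee\psi\to\chi)$; $\varphi\to(\psi\to\varphi)$; $\bot\to\varphi$; and rules: $\varphi,\varphi\to\psi\rhd\psi$; $\varphi,\psi\rhd\varphi\wedge\psi$; $\varphi\to\psi,\chi\to\theta\rhd(\psi\to\chi)\to(\varphi\to\theta)$; $\varphi\rhd(\varphi\to\psi)\to\psi$. $\mathrm{QSL}_w$ is the first-order logic axiomatised by all substitution instances (atoms replaced by first-order formulas) of the axioms/rules of $\mathrm{SL}_w$ plus: $(\forall x)\varphi(x)\to\varphi(t)$; $\varphi(t)\to(\exists x)\varphi(x)$; $\chi\to\psi\rhd\chi\to(\forall x)\psi$; $\psi\to\chi\rhd(\exists x)\psi\to\chi$ ($t$ substitutable for $x$, $x$ not free in $\chi$); $x=x$;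 $x=y\to y=x$; $x=y\to(y=z\to x=z)$; $x=y\to t(x)=t(y)$; $x=y\to(\varphi(x)\to\varphi(y))$. Write $t\neq s$ for $\neg(t=s)$. Arithmetical language: constant $\overline{0}$, unary $S$, binary $=,\leq$, ternary $A,M$; numerals $\overline{n}=S\cdots S(\overline{0})$ ($n$ times). $R^\backsim$: axioms $A(\overline{m},\overline{n},x)\leftrightarrow\overline{m+n}=x$; $M(\overline{m},\overline{n},x)\leftrightarrow\overline{m\cdot n}=x$; $\overline{m}\neq\overline{n}$ for $m\neq n$; $x\leq\overline{n}\leftrightarrow(x=\overline{0}\vee x=\overline{1}\vee\dots\vee x=\overline{n})$; $x\leq\overline{n}\vee\overline{n}\leq x$; $x\leq\overline{n}\vee\neg(x\leq\overline{n})$ (for all $m,n\in\mathbb{N}$). $Q^\backsim$: axioms $x=y\vee x\neq y$; $S(x)\neq\overline{0}$; $S(x)=S(y)\to x=y$; $x\neq\overline{0}\to(\exists y)(x=S(y))$; $A(x,\overline{0},y)\leftrightarrow x=y$; $A(x,S(y),z)\leftrightarrow(\exists u)(A(x,y,u)\wedge z=S(u))$; $M(x,\overline{0},y)\leftrightarrow y=\overline{0}$; $M(x,S(y),z)\to(\exists u)(M(x,y,u)\wedge A(u,x,z))$; $M(\overline{m},\overline{n},u)\to(A(u,\overline{n},x)\to M(\overline{m},\overline{n+1},x))$ for all $m,n$; $x\leq y\leftrightarrow(\exists z)A(z,x,y)$. *)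

theory Defs
  imports Main
begin

type_synonym var = nat

datatype tm = Var var | Zero | S tm

datatype fm =
    Bot ("\<^bold>\<bottom>")
  | Eq tm tm (infix "\<^bold>=" 60)
  | Le tm tm (infix "\<^bold>\<le>" 60)
  | A tm tm tm
  | M tm tm tm
  | Imp fm fm (infixr "\<^bold>\<rightarrow>" 45)
  | Conj fm fm (infixr "\<^bold>\<and>" 55)
  | Disj fm fm (infixr "\<^bold>\<or>" 50)
  | All var fm
  | Ex var fm

abbreviation Neg :: "fm \<Rightarrow> fm" ("\<^bold>\<not> _" [58] 58) where
  "\<^bold>\<not> \<phi> \<equiv> \<phi> \<^bold>\<rightarrow> \<^bold>\<bottom>"

abbreviation Iff :: "fm \<Rightarrow> fm \<Rightarrow> fm" (infix "\<^bold>\<leftrightarrow>" 44) where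
  "\<phi> \<^bold>\<leftrightarrow> \<psi> \<equiv> (\<phi> \<^bold>\<rightarrow> \<psi>) \<^bold>\<and> (\<psi> \<^bold>\<rightarrow> \<phi>)"

abbreviation Neq :: "tm \<Rightarrow> tm \<Rightarrow> fm" (infix "\<^bold>\<noteq>" 60) where
  "t \<^bold>\<noteq> s \<equiv> \<^bold>\<not> (t \<^bold>= s)"

primrec tvars :: "tm \<Rightarrow> var set" where
  "tvars (Var x) = {x}"
| "tvars Zero = {}"
| "tvars (S t) = tvars t"

primrec fv :: "fm \<Rightarrow> var set" where
  "fv \<^bold>\<bottom> = {}"
| "fv (t \<^bold>= s) = tvars t \<union> tvars s"
| "fv (t \<^bold>\<le> s) = tvars t \<union> tvars s"
| "fv (A r s t) = tvars r \<union> tvars s \<union> tvars t"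
| "fv (M r s t) = tvars r \<union> tvars s \<union> tvars t"
| "fv (\<phi> \<^bold>\<rightarrow> \<psi>) = fv \<phi> \<union> fv \<psi>"
| "fv (\<phi> \<^bold>\<and> \<psi>) = fv \<phi> \<union> fv \<psi>"
| "fv (\<phi> \<^bold>\<or> \<psi>) = fv \<phi> \<union> fv \<psi>"
| "fv (All y \<phi>) = fv \<phi> - {y}"
| "fv (Ex y \<phi>) = fv \<phi> - {y}"

primrec tsubst :: "var \<Rightarrow> tm \<Rightarrow> tm \<Rightarrow> tm" where
  "tsubst x t (Var y) = (if y = x then t else Var y)"
| "tsubst x t Zero = Zero"
| "tsubst x t (S s) = S (tsubst x t s)"

text \<open>\<open>subst x t \<phi>\<close> replaces the free occurrences of \<open>x\<close> in \<open>\<phi>\<close> by \<open>t\<close> without renaming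
  bound variables, so it is only meaningful under \<open>substitutable t x \<phi>\<close>.\<close>

primrec subst :: "var \<Rightarrow> tm \<Rightarrow> fm \<Rightarrow> fm" where
  "subst x t \<^bold>\<bottom> = \<^bold>\<bottom>"
| "subst x t (r \<^bold>= s) = (tsubst x t r \<^bold>= tsubst x t s)"
| "subst x t (r \<^bold>\<le> s) = (tsubst x t r \<^bold>\<le> tsubst x t s)"
| "subst x t (A p q r) = A (tsubst x t p) (tsubst x t q) (tsubst x t r)"
| "subst x t (M p q r) = M (tsubst x t p) (tsubst x t q) (tsubst x t r)"
| "subst x t (\<phi> \<^bold>\<rightarrow> \<psi>) = (subst x t \<phi> \<^bold>\<rightarrow> subst x t \<psi>)"
| "subst x t (\<phi> \<^bold>\<and> \<psi>) = (subst x t \<phi> \<^bold>\<and> subst x t \<psi>)"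
| "subst x t (\<phi> \<^bold>\<or> \<psi>) = (subst x t \<phi> \<^bold>\<or> subst x t \<psi>)"
| "subst x t (All y \<phi>) = (if y = x then All y \<phi> else All y (subst x t \<phi>))"
| "subst x t (Ex y \<phi>) = (if y = x then Ex y \<phi> else Ex y (subst x t \<phi>))"

primrec substitutable :: "tm \<Rightarrow> var \<Rightarrow> fm \<Rightarrow> bool" where
  "substitutable t x \<^bold>\<bottom> = True"
| "substitutable t x (r \<^bold>= s) = True"
| "substitutable t x (r \<^bold>\<le> s) = True"
| "substitutable t x (A p q r) = True"
| "substitutable t x (M p q r) = True"
| "substitutable t x (\<phi> \<^bold>\<rightarrow> \<psi>) = (substitutable t x \<phi> \<and> substitutable t x \<psi>)"
| "substitutable t x (\<phi> \<^bold>\<and> \<psi>) = (substitutable t x \<phi> \<and> substitutable t x \<psi>)"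
| "substitutable t x (\<phi> \<^bold>\<or> \<psi>) = (substitutable t x \<phi> \<and> substitutable t x \<psi>)"
| "substitutable t x (All y \<phi>) =
    (x \<notin> fv (All y \<phi>) \<or> (y \<notin> tvars t \<and> substitutable t x \<phi>))"
| "substitutable t x (Ex y \<phi>) =
    (x \<notin> fv (Ex y \<phi>) \<or> (y \<notin> tvars t \<and> substitutable t x \<phi>))"

text \<open>Derivability from a set \<open>T\<close> of possibly open formulas in \<open>QSL\<^sub>w\<close>. All rules apply to
  arbitrary consequences of \<open>T\<close>. The rules up to \<open>assertion\<close> are the first-order instances of
  \<open>SL\<^sub>w\<close>; as its axioms are schemata, their substitution instances are the schemata over \<open>fm\<close>.\<close>

inductive QSLw :: "fm set \<Rightarrow> fm \<Rightarrow> bool" (infix "\<turnstile>\<^sub>Q\<^sub>S\<^sub>L\<^sub>w" 40) for T :: "fm set" where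
  hyp: "\<phi> \<in> T \<Longrightarrow> T \<turnstile>\<^sub>Q\<^sub>S\<^sub>L\<^sub>w \<phi>"
| ident: "T \<turnstile>\<^sub>Q\<^sub>S\<^sub>L\<^sub>w \<phi> \<^bold>\<rightarrow> \<phi>"
| conjE1: "T \<turnstile>\<^sub>Q\<^sub>S\<^sub>L\<^sub>w (\<phi> \<^bold>\<and> \<psi>) \<^bold>\<rightarrow> \<phi>"
| conjE2: "T \<turnstile>\<^sub>Q\<^sub>S\<^sub>L\<^sub>w (\<phi> \<^bold>\<and> \<psi>) \<^bold>\<rightarrow> \<psi>"
| conj_imp: "T \<turnstile>\<^sub>Q\<^sub>S\<^sub>L\<^sub>w ((\<phi> \<^bold>\<rightarrow> \<psi>) \<^bold>\<and> (\<phi> \<^bold>\<rightarrow> \<chi>)) \<^bold>\<rightarrow> (\<phi> \<^bold>\<rightarrow> (\<psi> \<^bold>\<and> \<chi>))"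
| disjI1: "T \<turnstile>\<^sub>Q\<^sub>S\<^sub>L\<^sub>w \<phi> \<^bold>\<rightarrow> (\<phi> \<^bold>\<or> \<psi>)"
| disjI2: "T \<turnstile>\<^sub>Q\<^sub>S\<^sub>L\<^sub>w \<psi> \<^bold>\<rightarrow> (\<phi> \<^bold>\<or> \<psi>)"
| disj_imp: "T \<turnstile>\<^sub>Q\<^sub>S\<^sub>L\<^sub>w ((\<phi> \<^bold>\<rightarrow> \<chi>) \<^bold>\<and> (\<psi> \<^bold>\<rightarrow> \<chi>)) \<^bold>\<rightarrow> ((\<phi> \<^bold>\<or> \<psi>) \<^bold>\<rightarrow> \<chi>)"
| weak: "T \<turnstile>\<^sub>Q\<^sub>S\<^sub>L\<^sub>w \<phi> \<^bold>\<rightarrow> (\<psi> \<^bold>\<rightarrow> \<phi>)"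
| bot: "T \<turnstile>\<^sub>Q\<^sub>S\<^sub>L\<^sub>w \<^bold>\<bottom> \<^bold>\<rightarrow> \<phi>"
| mp: "T \<turnstile>\<^sub>Q\<^sub>S\<^sub>L\<^sub>w \<phi> \<Longrightarrow> T \<turnstile>\<^sub>Q\<^sub>S\<^sub>L\<^sub>w \<phi> \<^bold>\<rightarrow> \<psi> \<Longrightarrow> T \<turnstile>\<^sub>Q\<^sub>S\<^sub>L\<^sub>w \<psi>"
| adj: "T \<turnstile>\<^sub>Q\<^sub>S\<^sub>L\<^sub>w \<phi> \<Longrightarrow> T \<turnstile>\<^sub>Q\<^sub>S\<^sub>L\<^sub>w \<psi> \<Longrightarrow> T \<turnstile>\<^sub>Q\<^sub>S\<^sub>L\<^sub>w \<phi> \<^bold>\<and> \<psi>"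
| affix: "T \<turnstile>\<^sub>Q\<^sub>S\<^sub>L\<^sub>w \<phi> \<^bold>\<rightarrow> \<psi> \<Longrightarrow> T \<turnstile>\<^sub>Q\<^sub>S\<^sub>L\<^sub>w \<chi> \<^bold>\<rightarrow> \<theta> \<Longrightarrow>
    T \<turnstile>\<^sub>Q\<^sub>S\<^sub>L\<^sub>w (\<psi> \<^bold>\<rightarrow> \<chi>) \<^bold>\<rightarrow> (\<phi> \<^bold>\<rightarrow> \<theta>)"
| assertion: "T \<turnstile>\<^sub>Q\<^sub>S\<^sub>L\<^sub>w \<phi> \<Longrightarrow> T \<turnstile>\<^sub>Q\<^sub>S\<^sub>L\<^sub>w (\<phi> \<^bold>\<rightarrow> \<psi>) \<^bold>\<rightarrow> \<psi>"
| all_inst: "substitutable t x \<phi> \<Longrightarrow> T \<turnstile>\<^sub>Q\<^sub>S\<^sub>L\<^sub>w All x \<phi> \<^bold>\<rightarrow> subst x t \<phi>"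
| ex_inst: "substitutable t x \<phi> \<Longrightarrow> T \<turnstile>\<^sub>Q\<^sub>S\<^sub>L\<^sub>w subst x t \<phi> \<^bold>\<rightarrow> Ex x \<phi>"
| all_gen: "T \<turnstile>\<^sub>Q\<^sub>S\<^sub>L\<^sub>w \<chi> \<^bold>\<rightarrow> \<psi> \<Longrightarrow> x \<notin> fv \<chi> \<Longrightarrow> T \<turnstile>\<^sub>Q\<^sub>S\<^sub>L\<^sub>w \<chi> \<^bold>\<rightarrow> All x \<psi>"
| ex_gen: "T \<turnstile>\<^sub>Q\<^sub>S\<^sub>L\<^sub>w \<psi> \<^bold>\<rightarrow> \<chi> \<Longrightarrow> x \<notin> fv \<chi> \<Longrightarrow> T \<turnstile>\<^sub>Q\<^sub>S\<^sub>L\<^sub>w Ex x \<psi> \<^bold>\<rightarrow> \<chi>"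
| eq_refl: "T \<turnstile>\<^sub>Q\<^sub>S\<^sub>L\<^sub>w Var x \<^bold>= Var x"
| eq_sym: "T \<turnstile>\<^sub>Q\<^sub>S\<^sub>L\<^sub>w Var x \<^bold>= Var y \<^bold>\<rightarrow> Var y \<^bold>= Var x"
| eq_trans: "T \<turnstile>\<^sub>Q\<^sub>S\<^sub>L\<^sub>w Var x \<^bold>= Var y \<^bold>\<rightarrow> (Var y \<^bold>= Var z \<^bold>\<rightarrow> Var x \<^bold>= Var z)"
| eq_tm: "T \<turnstile>\<^sub>Q\<^sub>S\<^sub>L\<^sub>w Var x \<^bold>= Var y \<^bold>\<rightarrow> t \<^bold>= tsubst x (Var y) t"
| eq_fm: "substitutable (Var y) x \<phi> \<Longrightarrow>
    T \<turnstile>\<^sub>Q\<^sub>S\<^sub>L\<^sub>w Var x \<^bold>= Var y \<^bold>\<rightarrow> (\<phi> \<^bold>\<rightarrow> subst x (Var y) \<phi>)"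

primrec num :: "nat \<Rightarrow> tm" where
  "num 0 = Zero"
| "num (Suc n) = S (num n)"

text \<open>The free variables of the theories are four fixed distinct variables \<open>x\<close>, \<open>y\<close>, \<open>z\<close>, \<open>u\<close>.\<close>

abbreviation (input) vx :: var where "vx \<equiv> 0"
abbreviation (input) vy :: var where "vy \<equiv> 1"
abbreviation (input) vz :: var where "vz \<equiv> 2"
abbreviation (input) vu :: var where "vu \<equiv> 3"
abbreviation (input) X :: tm where "X \<equiv> Var vx"
abbreviation (input) Y :: tm where "Y \<equiv> Var vy"
abbreviation (input) Z :: tm where "Z \<equiv> Var vz"
abbreviation (input) U :: tm where "U \<equiv> Var vu"

primrec eq_some_upto :: "tm \<Rightarrow> nat \<Rightarrow> fm" where
  "eq_some_upto t 0 = (t \<^bold>= num 0)"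
| "eq_some_upto t (Suc n) = (eq_some_upto t n \<^bold>\<or> t \<^bold>= num (Suc n))"

definition R_sim :: "fm set" where
  "R_sim =
     {A (num m) (num n) X \<^bold>\<leftrightarrow> num (m + n) \<^bold>= X | m n. True}
   \<union> {M (num m) (num n) X \<^bold>\<leftrightarrow> num (m * n) \<^bold>= X | m n. True}
   \<union> {num m \<^bold>\<noteq> num n | m n. m \<noteq> n}
   \<union> {X \<^bold>\<le> num n \<^bold>\<leftrightarrow> eq_some_upto X n | n. True}
   \<union> {X \<^bold>\<le> num n \<^bold>\<or> num n \<^bold>\<le> X | n. True}
   \<union> {X \<^bold>\<le> num n \<^bold>\<or> \<^bold>\<not> (X \<^bold>\<le> num n) | n. True}"

text \<open>\<open>Q\<^sup>\<backsim>\<close> without its numeral-indexed axiom scheme for \<open>M\<close>.\<close>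

definition Q_sim_base :: "fm set" where
  "Q_sim_base = {
     X \<^bold>= Y \<^bold>\<or> X \<^bold>\<noteq> Y,
     S X \<^bold>\<noteq> Zero,
     S X \<^bold>= S Y \<^bold>\<rightarrow> X \<^bold>= Y,
     X \<^bold>\<noteq> Zero \<^bold>\<rightarrow> Ex vy (X \<^bold>= S Y),
     A X Zero Y \<^bold>\<leftrightarrow> X \<^bold>= Y,
     A X (S Y) Z \<^bold>\<leftrightarrow> Ex vu (A X Y U \<^bold>\<and> Z \<^bold>= S U),
     M X Zero Y \<^bold>\<leftrightarrow> Y \<^bold>= Zero,
     M X (S Y) Z \<^bold>\<rightarrow> Ex vu (M X Y U \<^bold>\<and> A U X Z),
     X \<^bold>\<le> Y \<^bold>\<leftrightarrow> Ex vz (A Z X Y)}"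

text \<open>The remaining scheme is printed with \<open>A(u, n, x)\<close>. Since \<open>m * (n + 1) = m * n + m\<close>, this is
  evidently a slip for \<open>A(u, m, x)\<close>: the printed instance \<open>m = 1\<close>, \<open>n = 0\<close> yields \<open>M(1, 1, 0)\<close>,
  which the recursion axiom for \<open>M\<close> refutes, so \<open>Q_sim_printed\<close> is inconsistent.
  \<open>Q_sim\<close> is the intended theory.\<close>

definition Q_sim_printed :: "fm set" where
  "Q_sim_printed = Q_sim_base \<union>
     {M (num m) (num n) U \<^bold>\<rightarrow> (A U (num n) X \<^bold>\<rightarrow> M (num m) (num (n + 1)) X) | m n. True}"

definition Q_sim :: "fm set" where
  "Q_sim = Q_sim_base \<union>
     {M (num m) (num n) U \<^bold>\<rightarrow> (A U (num m) X \<^bold>\<rightarrow> M (num m) (num (n + 1)) X) | m n. True}"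

end

theory Submission
  imports Defs
begin

text \<open>The logic lacks exchange, contraction and a deduction theorem, so every step is arranged to
  use only two strong principles. First, replacement together with the assertion rule shows that a
  theorem \<open>F(s)\<close> yields the theorem \<open>s = t \<rightarrow> F(t)\<close>; taking an implication for \<open>F\<close> avoids having to
  transfer hypotheses one at a time. Second, equality is decidable, which gives proofs by cases and
  lets a conjunction \<open>e \<and> \<psi>\<close> with an equation \<open>e\<close> be used like \<open>e \<rightarrow> (\<psi> \<rightarrow> \<dots>)\<close>. The axioms of \<open>R\<close> then
  follow by inductions on numerals. With the multiplication scheme as printed, \<open>M(1, 1, 0)\<close> is
  derivable, and hence so is everything.\<close>

section \<open>Propositional rules\<close>

lemma imp_trans:
  assumes "T \<turnstile>\<^sub>Q\<^sub>S\<^sub>L\<^sub>w \<phi> \<^bold>\<rightarrow> \<psi>" "T \<turnstile>\<^sub>Q\<^sub>S\<^sub>L\<^sub>w \<psi> \<^bold>\<rightarrow> \<chi>"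
  shows "T \<turnstile>\<^sub>Q\<^sub>S\<^sub>L\<^sub>w \<phi> \<^bold>\<rightarrow> \<chi>"
  using mp[OF assms(2) affix[OF assms(1) ident]] .

lemma imp_weaken: "T \<turnstile>\<^sub>Q\<^sub>S\<^sub>L\<^sub>w \<psi> \<Longrightarrow> T \<turnstile>\<^sub>Q\<^sub>S\<^sub>L\<^sub>w \<phi> \<^bold>\<rightarrow> \<psi>"
  using mp weak by blast

lemma imp_conjI:
  assumes "T \<turnstile>\<^sub>Q\<^sub>S\<^sub>L\<^sub>w \<phi> \<^bold>\<rightarrow> \<psi>" "T \<turnstile>\<^sub>Q\<^sub>S\<^sub>L\<^sub>w \<phi> \<^bold>\<rightarrow> \<chi>"
  shows "T \<turnstile>\<^sub>Q\<^sub>S\<^sub>L\<^sub>w \<phi> \<^bold>\<rightarrow> (\<psi> \<^bold>\<and> \<chi>)"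
  using mp[OF adj[OF assms] conj_imp] .

lemma imp_disjE:
  assumes "T \<turnstile>\<^sub>Q\<^sub>S\<^sub>L\<^sub>w \<phi> \<^bold>\<rightarrow> \<chi>" "T \<turnstile>\<^sub>Q\<^sub>S\<^sub>L\<^sub>w \<psi> \<^bold>\<rightarrow> \<chi>"
  shows "T \<turnstile>\<^sub>Q\<^sub>S\<^sub>L\<^sub>w (\<phi> \<^bold>\<or> \<psi>) \<^bold>\<rightarrow> \<chi>"
  using mp[OF adj[OF assms] disj_imp] .

lemma imp_disjI1: "T \<turnstile>\<^sub>Q\<^sub>S\<^sub>L\<^sub>w \<phi> \<^bold>\<rightarrow> \<psi> \<Longrightarrow> T \<turnstile>\<^sub>Q\<^sub>S\<^sub>L\<^sub>w \<phi> \<^bold>\<rightarrow> (\<psi> \<^bold>\<or> \<chi>)"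
  using imp_trans disjI1 by blast

lemma imp_disjI2: "T \<turnstile>\<^sub>Q\<^sub>S\<^sub>L\<^sub>w \<phi> \<^bold>\<rightarrow> \<chi> \<Longrightarrow> T \<turnstile>\<^sub>Q\<^sub>S\<^sub>L\<^sub>w \<phi> \<^bold>\<rightarrow> (\<psi> \<^bold>\<or> \<chi>)"
  using imp_trans disjI2 by blast

lemma conjD1: "T \<turnstile>\<^sub>Q\<^sub>S\<^sub>L\<^sub>w \<phi> \<^bold>\<and> \<psi> \<Longrightarrow> T \<turnstile>\<^sub>Q\<^sub>S\<^sub>L\<^sub>w \<phi>"
  using mp conjE1 by blast

lemma conjD2: "T \<turnstile>\<^sub>Q\<^sub>S\<^sub>L\<^sub>w \<phi> \<^bold>\<and> \<psi> \<Longrightarrow> T \<turnstile>\<^sub>Q\<^sub>S\<^sub>L\<^sub>w \<psi>"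
  using mp conjE2 by blast

lemma disj_cases:
  assumes "T \<turnstile>\<^sub>Q\<^sub>S\<^sub>L\<^sub>w \<phi> \<^bold>\<or> \<psi>" "T \<turnstile>\<^sub>Q\<^sub>S\<^sub>L\<^sub>w \<phi> \<^bold>\<rightarrow> \<chi>" "T \<turnstile>\<^sub>Q\<^sub>S\<^sub>L\<^sub>w \<psi> \<^bold>\<rightarrow> \<chi>"
  shows "T \<turnstile>\<^sub>Q\<^sub>S\<^sub>L\<^sub>w \<chi>"
  using mp[OF assms(1) imp_disjE[OF assms(2,3)]] .

lemma imp_prefix: "T \<turnstile>\<^sub>Q\<^sub>S\<^sub>L\<^sub>w \<phi> \<^bold>\<rightarrow> \<psi> \<Longrightarrow> T \<turnstile>\<^sub>Q\<^sub>S\<^sub>L\<^sub>w (\<psi> \<^bold>\<rightarrow> \<chi>) \<^bold>\<rightarrow> (\<phi> \<^bold>\<rightarrow> \<chi>)"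
  using affix ident by blast

lemma imp_mp:
  assumes "T \<turnstile>\<^sub>Q\<^sub>S\<^sub>L\<^sub>w \<phi> \<^bold>\<rightarrow> (\<psi> \<^bold>\<rightarrow> \<chi>)" "T \<turnstile>\<^sub>Q\<^sub>S\<^sub>L\<^sub>w \<psi>"
  shows "T \<turnstile>\<^sub>Q\<^sub>S\<^sub>L\<^sub>w \<phi> \<^bold>\<rightarrow> \<chi>"
  using imp_trans[OF assms(1) assertion[OF assms(2)]] .

text \<open>Importation fails without contraction; decidability of \<open>\<epsilon>\<close> makes up for it.\<close>

lemma conj_decidable_imp:
  assumes dec: "T \<turnstile>\<^sub>Q\<^sub>S\<^sub>L\<^sub>w \<epsilon> \<^bold>\<or> \<^bold>\<not> \<epsilon>"
    and "T \<turnstile>\<^sub>Q\<^sub>S\<^sub>L\<^sub>w \<phi> \<^bold>\<rightarrow> \<epsilon>" and "T \<turnstile>\<^sub>Q\<^sub>S\<^sub>L\<^sub>w \<epsilon> \<^bold>\<rightarrow> (\<psi> \<^bold>\<rightarrow> \<chi>)"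
  shows "T \<turnstile>\<^sub>Q\<^sub>S\<^sub>L\<^sub>w (\<phi> \<^bold>\<and> \<psi>) \<^bold>\<rightarrow> \<chi>"
  using dec
proof (rule disj_cases)
  show "T \<turnstile>\<^sub>Q\<^sub>S\<^sub>L\<^sub>w \<epsilon> \<^bold>\<rightarrow> ((\<phi> \<^bold>\<and> \<psi>) \<^bold>\<rightarrow> \<chi>)"
    by (rule imp_trans[OF assms(3) imp_prefix[OF conjE2]])
  show "T \<turnstile>\<^sub>Q\<^sub>S\<^sub>L\<^sub>w \<^bold>\<not> \<epsilon> \<^bold>\<rightarrow> ((\<phi> \<^bold>\<and> \<psi>) \<^bold>\<rightarrow> \<chi>)"
    by (rule affix[OF imp_trans[OF conjE1 assms(2)] bot])
qed

lemma decidable_disj: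
  assumes "T \<turnstile>\<^sub>Q\<^sub>S\<^sub>L\<^sub>w \<phi> \<^bold>\<or> \<^bold>\<not> \<phi>" "T \<turnstile>\<^sub>Q\<^sub>S\<^sub>L\<^sub>w \<psi> \<^bold>\<or> \<^bold>\<not> \<psi>"
  shows "T \<turnstile>\<^sub>Q\<^sub>S\<^sub>L\<^sub>w (\<phi> \<^bold>\<or> \<psi>) \<^bold>\<or> \<^bold>\<not> (\<phi> \<^bold>\<or> \<psi>)" (is "_ \<turnstile>\<^sub>Q\<^sub>S\<^sub>L\<^sub>w ?D")
  using assms(1)
proof (rule disj_cases)
  show "T \<turnstile>\<^sub>Q\<^sub>S\<^sub>L\<^sub>w \<phi> \<^bold>\<rightarrow> ?D" by (rule imp_disjI1[OF disjI1])
  have "T \<turnstile>\<^sub>Q\<^sub>S\<^sub>L\<^sub>w \<^bold>\<not> \<phi> \<^bold>\<rightarrow> (\<^bold>\<not> \<psi> \<^bold>\<rightarrow> (\<^bold>\<not> \<phi> \<^bold>\<and> \<^bold>\<not> \<psi>))"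
    by (rule imp_trans[OF imp_conjI[OF weak imp_weaken[OF ident]] conj_imp])
  moreover have "T \<turnstile>\<^sub>Q\<^sub>S\<^sub>L\<^sub>w (\<^bold>\<not> \<psi> \<^bold>\<rightarrow> (\<^bold>\<not> \<phi> \<^bold>\<and> \<^bold>\<not> \<psi>)) \<^bold>\<rightarrow> (\<^bold>\<not> \<psi> \<^bold>\<rightarrow> ?D)"
    by (rule affix[OF ident imp_disjI2[OF disj_imp]])
  ultimately have 1: "T \<turnstile>\<^sub>Q\<^sub>S\<^sub>L\<^sub>w \<^bold>\<not> \<phi> \<^bold>\<rightarrow> (\<^bold>\<not> \<psi> \<^bold>\<rightarrow> ?D)" by (rule imp_trans)
  have 2: "T \<turnstile>\<^sub>Q\<^sub>S\<^sub>L\<^sub>w \<^bold>\<not> \<phi> \<^bold>\<rightarrow> (\<psi> \<^bold>\<rightarrow> ?D)" by (rule imp_weaken[OF imp_disjI1[OF disjI2]])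
  show "T \<turnstile>\<^sub>Q\<^sub>S\<^sub>L\<^sub>w \<^bold>\<not> \<phi> \<^bold>\<rightarrow> ?D"
    by (rule imp_mp[OF imp_trans[OF imp_conjI[OF 2 1] disj_imp] assms(2)])
qed

lemma decidable_iff:
  assumes "T \<turnstile>\<^sub>Q\<^sub>S\<^sub>L\<^sub>w \<phi> \<^bold>\<leftrightarrow> \<psi>" "T \<turnstile>\<^sub>Q\<^sub>S\<^sub>L\<^sub>w \<psi> \<^bold>\<or> \<^bold>\<not> \<psi>"
  shows "T \<turnstile>\<^sub>Q\<^sub>S\<^sub>L\<^sub>w \<phi> \<^bold>\<or> \<^bold>\<not> \<phi>"
  by (rule disj_cases[OF assms(2)
        imp_disjI1[OF conjD2[OF assms(1)]] imp_disjI2[OF imp_prefix[OF conjD1[OF assms(1)]]]])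

section \<open>Substitution and replacement\<close>

lemma finite_tvars [simp]: "finite (tvars t)"
  by (induction t) auto

lemma finite_fv [simp]: "finite (fv \<phi>)"
  by (induction \<phi>) auto

lemma tsubst_fresh [simp]: "x \<notin> tvars s \<Longrightarrow> tsubst x t s = s"
  by (induction s) auto

lemma tvars_num [simp]: "tvars (num n) = {}"
  by (induction n) auto

lemma tsubst_tsubst_Var [simp]:
  "w \<notin> tvars s \<Longrightarrow> tsubst w t (tsubst v (Var w) s) = tsubst v t s"
  by (induction s) auto

primrec qfree :: "fm \<Rightarrow> bool" where
  "qfree \<^bold>\<bottom> = True"
| "qfree (t \<^bold>= s) = True"
| "qfree (t \<^bold>\<le> s) = True"
| "qfree (A r s t) = True"
| "qfree (M r s t) = True"
| "qfree (\<phi> \<^bold>\<rightarrow> \<psi>) = (qfree \<phi> \<and> qfree \<psi>)"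
| "qfree (\<phi> \<^bold>\<and> \<psi>) = (qfree \<phi> \<and> qfree \<psi>)"
| "qfree (\<phi> \<^bold>\<or> \<psi>) = (qfree \<phi> \<and> qfree \<psi>)"
| "qfree (All y \<phi>) = False"
| "qfree (Ex y \<phi>) = False"

lemma substitutable_qfree [simp]: "qfree \<phi> \<Longrightarrow> substitutable t x \<phi>"
  by (induction \<phi>) auto

lemma qfree_subst [simp]: "qfree \<phi> \<Longrightarrow> qfree (subst x t \<phi>)"
  by (induction \<phi>) auto

lemma subst_fresh_qfree: "qfree \<phi> \<Longrightarrow> x \<notin> fv \<phi> \<Longrightarrow> subst x t \<phi> = \<phi>"
  by (induction \<phi>) auto

lemma subst_subst_Var_qfree:
  "qfree \<phi> \<Longrightarrow> w \<notin> fv \<phi> \<Longrightarrow> subst w t (subst v (Var w) \<phi>) = subst v t \<phi>"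
  by (induction \<phi>) auto

lemma qfree_eq_some_upto [simp]: "qfree (eq_some_upto t n)"
  by (induction n) auto

lemma subst_eq_some_upto [simp]:
  "subst x s (eq_some_upto t n) = eq_some_upto (tsubst x s t) n"
  by (induction n) auto

lemma derivable_subst:
  assumes "T \<turnstile>\<^sub>Q\<^sub>S\<^sub>L\<^sub>w \<phi>" "substitutable t x \<phi>"
  shows "T \<turnstile>\<^sub>Q\<^sub>S\<^sub>L\<^sub>w subst x t \<phi>"
proof -
  have "T \<turnstile>\<^sub>Q\<^sub>S\<^sub>L\<^sub>w (\<^bold>\<bottom> \<^bold>\<rightarrow> \<^bold>\<bottom>) \<^bold>\<rightarrow> All x \<phi>"
    by (rule all_gen[OF imp_weaken[OF assms(1)]]) simp
  from mp[OF mp[OF ident this] all_inst[OF assms(2)]] show ?thesis .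
qed

lemma eq_refl_tm: "T \<turnstile>\<^sub>Q\<^sub>S\<^sub>L\<^sub>w t \<^bold>= t"
  using derivable_subst[OF eq_refl[of T 0], of t 0] by simp

lemma ex_fresh:
  assumes "finite (B :: var set)"
  obtains w where "w \<notin> B"
  using ex_new_if_finite[OF infinite_UNIV_nat assms] by blast

lemma fresh_pair:
  assumes "finite B"
  obtains p q :: var where "p \<notin> B" "q \<notin> B" "3 < p" "p < q"
proof -
  obtain N where N: "\<forall>x \<in> insert 3 B. x \<le> N"
    using finite_nat_set_iff_bounded_le[of "insert 3 B"] assms by auto
  show thesis
    by (rule that[of "Suc N" "Suc (Suc N)"]) (use N in force)+
qed

lemma eq_replace:
  assumes q: "qfree \<phi>"
  shows "T \<turnstile>\<^sub>Q\<^sub>S\<^sub>L\<^sub>w s \<^bold>= t \<^bold>\<rightarrow> (subst v s \<phi> \<^bold>\<rightarrow> subst v t \<phi>)"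
proof -
  obtain w where w: "w \<notin> fv \<phi> \<union> {v} \<union> tvars s"
    by (rule ex_fresh[of "fv \<phi> \<union> {v} \<union> tvars s"]) auto
  have fresh: "w \<notin> fv (subst v r \<phi>)" if "w \<notin> tvars r" for r
  proof -
    have *: "w \<notin> tvars (tsubst v r a)" if "w \<notin> tvars a" for a
      using that \<open>w \<notin> tvars r\<close> by (induction a) auto
    show ?thesis using q w by (induction \<phi>) (auto simp: *)
  qed
  have "T \<turnstile>\<^sub>Q\<^sub>S\<^sub>L\<^sub>w Var v \<^bold>= Var w \<^bold>\<rightarrow> (\<phi> \<^bold>\<rightarrow> subst v (Var w) \<phi>)"
    by (rule eq_fm) (simp add: q)
  from derivable_subst[OF this, of s v]
  have "T \<turnstile>\<^sub>Q\<^sub>S\<^sub>L\<^sub>w s \<^bold>= Var w \<^bold>\<rightarrow> (subst v s \<phi> \<^bold>\<rightarrow> subst v s (subst v (Var w) \<phi>))"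
    using q w by simp
  moreover have "subst v s (subst v (Var w) \<phi>) = subst v (Var w) \<phi>"
  proof -
    have *: "tsubst v s (tsubst v (Var w) a) = tsubst v (Var w) a" for a
      using w by (induction a) auto
    show ?thesis using q by (induction \<phi>) (auto simp: *)
  qed
  ultimately have "T \<turnstile>\<^sub>Q\<^sub>S\<^sub>L\<^sub>w s \<^bold>= Var w \<^bold>\<rightarrow> (subst v s \<phi> \<^bold>\<rightarrow> subst v (Var w) \<phi>)"
    by simp
  from derivable_subst[OF this, of t w] show ?thesis
    using q w fresh[of s] by (simp add: subst_subst_Var_qfree subst_fresh_qfree)
qed

lemma eq_replace_thm:
  assumes "T \<turnstile>\<^sub>Q\<^sub>S\<^sub>L\<^sub>w subst v s \<phi>" "qfree \<phi>"
  shows "T \<turnstile>\<^sub>Q\<^sub>S\<^sub>L\<^sub>w s \<^bold>= t \<^bold>\<rightarrow> subst v t \<phi>"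
  using imp_mp[OF eq_replace[OF assms(2)] assms(1)] .

lemma eq_sym_tm: "T \<turnstile>\<^sub>Q\<^sub>S\<^sub>L\<^sub>w s \<^bold>= t \<^bold>\<rightarrow> t \<^bold>= s"
proof -
  obtain v where "v \<notin> tvars s" by (rule ex_fresh[of "tvars s"]) auto
  with eq_replace_thm[of T v s "Var v \<^bold>= s" t] show ?thesis by (simp add: eq_refl_tm)
qed

lemma eq_S_cong: "T \<turnstile>\<^sub>Q\<^sub>S\<^sub>L\<^sub>w s \<^bold>= t \<^bold>\<rightarrow> S s \<^bold>= S t"
proof -
  obtain v where "v \<notin> tvars s" by (rule ex_fresh[of "tvars s"]) auto
  with eq_replace_thm[of T v s "S s \<^bold>= S (Var v)" t] show ?thesis by (simp add: eq_refl_tm)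
qed

section \<open>Instances of the axioms\<close>

context
  fixes T :: "fm set"
  assumes base: "Q_sim_base \<subseteq> T"
begin

text \<open>The variables of an axiom are first renamed to fresh ones, so that successive substitutions
  do not interfere.\<close>

lemma eq_decidable: "T \<turnstile>\<^sub>Q\<^sub>S\<^sub>L\<^sub>w s \<^bold>= t \<^bold>\<or> s \<^bold>\<noteq> t"
proof -
  obtain p :: var where fresh: "p \<notin> tvars s" "p \<notin> tvars t" "3 < p"
    by (rule fresh_pair[of "tvars s \<union> tvars t"]) auto
  have 0: "T \<turnstile>\<^sub>Q\<^sub>S\<^sub>L\<^sub>w X \<^bold>= Y \<^bold>\<or> X \<^bold>\<noteq> Y" using base by (intro hyp) (auto simp: Q_sim_base_def)
  note 1 = derivable_subst[OF 0, of "Var p" 0, simplified]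
  have 2: "T \<turnstile>\<^sub>Q\<^sub>S\<^sub>L\<^sub>w Var p \<^bold>= t \<^bold>\<or> Var p \<^bold>\<noteq> t"
    using derivable_subst[OF 1, of t 1] fresh by simp
  show ?thesis using derivable_subst[OF 2, of s p] fresh by simp
qed

lemma S_neq_Zero: "T \<turnstile>\<^sub>Q\<^sub>S\<^sub>L\<^sub>w S t \<^bold>\<noteq> Zero"
proof -
  have "T \<turnstile>\<^sub>Q\<^sub>S\<^sub>L\<^sub>w S X \<^bold>\<noteq> Zero" using base by (intro hyp) (auto simp: Q_sim_base_def)
  from derivable_subst[OF this, of t 0] show ?thesis by simp
qed

lemma S_inject: "T \<turnstile>\<^sub>Q\<^sub>S\<^sub>L\<^sub>w S s \<^bold>= S t \<^bold>\<rightarrow> s \<^bold>= t"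
proof -
  obtain p :: var where fresh: "p \<notin> tvars s" "p \<notin> tvars t" "3 < p"
    by (rule fresh_pair[of "tvars s \<union> tvars t"]) auto
  have 0: "T \<turnstile>\<^sub>Q\<^sub>S\<^sub>L\<^sub>w S X \<^bold>= S Y \<^bold>\<rightarrow> X \<^bold>= Y" using base by (intro hyp) (auto simp: Q_sim_base_def)
  note 1 = derivable_subst[OF 0, of "Var p" 0, simplified]
  have 2: "T \<turnstile>\<^sub>Q\<^sub>S\<^sub>L\<^sub>w S (Var p) \<^bold>= S t \<^bold>\<rightarrow> Var p \<^bold>= t"
    using derivable_subst[OF 1, of t 1] fresh by simp
  show ?thesis using derivable_subst[OF 2, of s p] fresh by simp
qed

lemma neq_Zero_imp_ex_S: "1 \<notin> tvars t \<Longrightarrow> T \<turnstile>\<^sub>Q\<^sub>S\<^sub>L\<^sub>w t \<^bold>\<noteq> Zero \<^bold>\<rightarrow> Ex vy (t \<^bold>= S Y)"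
proof -
  assume t: "1 \<notin> tvars t"
  have "T \<turnstile>\<^sub>Q\<^sub>S\<^sub>L\<^sub>w X \<^bold>\<noteq> Zero \<^bold>\<rightarrow> Ex vy (X \<^bold>= S Y)"
    using base by (intro hyp) (auto simp: Q_sim_base_def)
  from derivable_subst[OF this, of t 0] t show ?thesis by simp
qed

lemma A_Zero: "T \<turnstile>\<^sub>Q\<^sub>S\<^sub>L\<^sub>w A s Zero t \<^bold>\<leftrightarrow> s \<^bold>= t"
proof -
  obtain p :: var where fresh: "p \<notin> tvars s" "p \<notin> tvars t" "3 < p"
    by (rule fresh_pair[of "tvars s \<union> tvars t"]) auto
  have 0: "T \<turnstile>\<^sub>Q\<^sub>S\<^sub>L\<^sub>w A X Zero Y \<^bold>\<leftrightarrow> X \<^bold>= Y" using base by (intro hyp) (auto simp: Q_sim_base_def)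
  note 1 = derivable_subst[OF 0, of "Var p" 0, simplified]
  have 2: "T \<turnstile>\<^sub>Q\<^sub>S\<^sub>L\<^sub>w A (Var p) Zero t \<^bold>\<leftrightarrow> Var p \<^bold>= t"
    using derivable_subst[OF 1, of t 1] fresh by simp
  show ?thesis using derivable_subst[OF 2, of s p] fresh by simp
qed

lemma A_S:
  assumes "3 \<notin> tvars a" "3 \<notin> tvars b" "3 \<notin> tvars c"
  shows "T \<turnstile>\<^sub>Q\<^sub>S\<^sub>L\<^sub>w A a (S b) c \<^bold>\<leftrightarrow> Ex vu (A a b U \<^bold>\<and> c \<^bold>= S U)"
proof -
  obtain p q :: var where fresh: "p \<notin> tvars a" "p \<notin> tvars b" "p \<notin> tvars c"
    "q \<notin> tvars a" "q \<notin> tvars b" "q \<notin> tvars c" "3 < p" "p < q"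
    by (rule fresh_pair[of "tvars a \<union> tvars b \<union> tvars c"]) auto
  have 0: "T \<turnstile>\<^sub>Q\<^sub>S\<^sub>L\<^sub>w A X (S Y) Z \<^bold>\<leftrightarrow> Ex vu (A X Y U \<^bold>\<and> Z \<^bold>= S U)"
    using base by (intro hyp) (auto simp: Q_sim_base_def)
  have 1: "T \<turnstile>\<^sub>Q\<^sub>S\<^sub>L\<^sub>w A (Var p) (S Y) Z \<^bold>\<leftrightarrow> Ex vu (A (Var p) Y U \<^bold>\<and> Z \<^bold>= S U)"
    using derivable_subst[OF 0, of "Var p" 0] fresh by simp
  have 2: "T \<turnstile>\<^sub>Q\<^sub>S\<^sub>L\<^sub>w A (Var p) (S (Var q)) Z \<^bold>\<leftrightarrow> Ex vu (A (Var p) (Var q) U \<^bold>\<and> Z \<^bold>= S U)"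
    using derivable_subst[OF 1, of "Var q" 1] fresh by simp
  have 3: "T \<turnstile>\<^sub>Q\<^sub>S\<^sub>L\<^sub>w A (Var p) (S (Var q)) c \<^bold>\<leftrightarrow> Ex vu (A (Var p) (Var q) U \<^bold>\<and> c \<^bold>= S U)"
    using derivable_subst[OF 2, of c 2] fresh assms by simp
  have 4: "T \<turnstile>\<^sub>Q\<^sub>S\<^sub>L\<^sub>w A (Var p) (S b) c \<^bold>\<leftrightarrow> Ex vu (A (Var p) b U \<^bold>\<and> c \<^bold>= S U)"
    using derivable_subst[OF 3, of b q] fresh assms by simp
  show ?thesis using derivable_subst[OF 4, of a p] fresh assms by simp
qed

lemma M_Zero: "T \<turnstile>\<^sub>Q\<^sub>S\<^sub>L\<^sub>w M s Zero t \<^bold>\<leftrightarrow> t \<^bold>= Zero"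
proof -
  obtain p :: var where fresh: "p \<notin> tvars s" "p \<notin> tvars t" "3 < p"
    by (rule fresh_pair[of "tvars s \<union> tvars t"]) auto
  have 0: "T \<turnstile>\<^sub>Q\<^sub>S\<^sub>L\<^sub>w M X Zero Y \<^bold>\<leftrightarrow> Y \<^bold>= Zero" using base by (intro hyp) (auto simp: Q_sim_base_def)
  note 1 = derivable_subst[OF 0, of "Var p" 0, simplified]
  have 2: "T \<turnstile>\<^sub>Q\<^sub>S\<^sub>L\<^sub>w M (Var p) Zero t \<^bold>\<leftrightarrow> t \<^bold>= Zero"
    using derivable_subst[OF 1, of t 1] fresh by simp
  show ?thesis using derivable_subst[OF 2, of s p] fresh by simp
qed

lemma M_S_num:
  assumes "3 \<notin> tvars c"
  shows "T \<turnstile>\<^sub>Q\<^sub>S\<^sub>L\<^sub>w M (num m) (S (num n)) c \<^bold>\<rightarrow> Ex vu (M (num m) (num n) U \<^bold>\<and> A U (num m) c)"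
proof -
  have 0: "T \<turnstile>\<^sub>Q\<^sub>S\<^sub>L\<^sub>w M X (S Y) Z \<^bold>\<rightarrow> Ex vu (M X Y U \<^bold>\<and> A U X Z)"
    using base by (intro hyp) (auto simp: Q_sim_base_def)
  have 1: "T \<turnstile>\<^sub>Q\<^sub>S\<^sub>L\<^sub>w M (num m) (S Y) Z \<^bold>\<rightarrow> Ex vu (M (num m) Y U \<^bold>\<and> A U (num m) Z)"
    using derivable_subst[OF 0, of "num m" 0] by simp
  have 2: "T \<turnstile>\<^sub>Q\<^sub>S\<^sub>L\<^sub>w M (num m) (S (num n)) Z \<^bold>\<rightarrow> Ex vu (M (num m) (num n) U \<^bold>\<and> A U (num m) Z)"
    using derivable_subst[OF 1, of "num n" 1] by simp
  show ?thesis using derivable_subst[OF 2, of c 2] assms by simp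
qed

lemma Le_iff:
  assumes "2 \<notin> tvars s" "2 \<notin> tvars t"
  shows "T \<turnstile>\<^sub>Q\<^sub>S\<^sub>L\<^sub>w s \<^bold>\<le> t \<^bold>\<leftrightarrow> Ex vz (A Z s t)"
proof -
  obtain p :: var where fresh: "p \<notin> tvars s" "p \<notin> tvars t" "3 < p"
    by (rule fresh_pair[of "tvars s \<union> tvars t"]) auto
  have 0: "T \<turnstile>\<^sub>Q\<^sub>S\<^sub>L\<^sub>w X \<^bold>\<le> Y \<^bold>\<leftrightarrow> Ex vz (A Z X Y)"
    using base by (intro hyp) (auto simp: Q_sim_base_def)
  have 1: "T \<turnstile>\<^sub>Q\<^sub>S\<^sub>L\<^sub>w Var p \<^bold>\<le> Y \<^bold>\<leftrightarrow> Ex vz (A Z (Var p) Y)"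
    using derivable_subst[OF 0, of "Var p" 0] fresh by simp
  have 2: "T \<turnstile>\<^sub>Q\<^sub>S\<^sub>L\<^sub>w Var p \<^bold>\<le> t \<^bold>\<leftrightarrow> Ex vz (A Z (Var p) t)"
    using derivable_subst[OF 1, of t 1] fresh assms by simp
  show ?thesis using derivable_subst[OF 2, of s p] fresh assms by simp
qed

lemma A_imp_Le:
  assumes "2 \<notin> tvars s" "2 \<notin> tvars t"
  shows "T \<turnstile>\<^sub>Q\<^sub>S\<^sub>L\<^sub>w A r s t \<^bold>\<rightarrow> s \<^bold>\<le> t"
  using imp_trans[OF ex_inst[of r 2 "A Z s t" T] conjD2[OF Le_iff]] assms by simp

lemma A_S_intro:
  assumes "3 \<notin> tvars a" "3 \<notin> tvars b" "3 \<notin> tvars c"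
  shows "T \<turnstile>\<^sub>Q\<^sub>S\<^sub>L\<^sub>w (A a b d \<^bold>\<and> c \<^bold>= S d) \<^bold>\<rightarrow> A a (S b) c"
  using imp_trans[OF ex_inst[of d 3 "A a b U \<^bold>\<and> c \<^bold>= S U" T] conjD2[OF A_S]] assms by simp

lemma A_S_elim:
  assumes "3 \<notin> tvars a" "3 \<notin> tvars b" "3 \<notin> tvars c" "3 \<notin> fv \<chi>"
    and "T \<turnstile>\<^sub>Q\<^sub>S\<^sub>L\<^sub>w (A a b U \<^bold>\<and> c \<^bold>= S U) \<^bold>\<rightarrow> \<chi>"
  shows "T \<turnstile>\<^sub>Q\<^sub>S\<^sub>L\<^sub>w A a (S b) c \<^bold>\<rightarrow> \<chi>"
  using imp_trans[OF conjD1[OF A_S[OF assms(1-3)]] ex_gen[OF assms(5,4)]] .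

lemma Zero_S_cases:
  assumes "qfree \<phi>" "1 \<notin> fv (subst v t \<phi>)" "1 \<notin> tvars t"
    and "T \<turnstile>\<^sub>Q\<^sub>S\<^sub>L\<^sub>w subst v Zero \<phi>" "T \<turnstile>\<^sub>Q\<^sub>S\<^sub>L\<^sub>w subst v (S Y) \<phi>"
  shows "T \<turnstile>\<^sub>Q\<^sub>S\<^sub>L\<^sub>w subst v t \<phi>"
proof (rule disj_cases[OF eq_decidable[of t Zero]])
  show "T \<turnstile>\<^sub>Q\<^sub>S\<^sub>L\<^sub>w t \<^bold>= Zero \<^bold>\<rightarrow> subst v t \<phi>"
    by (rule imp_trans[OF eq_sym_tm eq_replace_thm[OF assms(4,1)]])
  have "T \<turnstile>\<^sub>Q\<^sub>S\<^sub>L\<^sub>w t \<^bold>= S Y \<^bold>\<rightarrow> subst v t \<phi>"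
    by (rule imp_trans[OF eq_sym_tm eq_replace_thm[OF assms(5,1)]])
  from imp_trans[OF neq_Zero_imp_ex_S[OF assms(3)] ex_gen[OF this assms(2)]]
  show "T \<turnstile>\<^sub>Q\<^sub>S\<^sub>L\<^sub>w t \<^bold>\<noteq> Zero \<^bold>\<rightarrow> subst v t \<phi>" .
qed

section \<open>Numerals\<close>

lemma num_neq_num:
  "m \<noteq> n \<Longrightarrow> T \<turnstile>\<^sub>Q\<^sub>S\<^sub>L\<^sub>w num m \<^bold>\<noteq> num n"
proof (induction m arbitrary: n)
  case 0
  then obtain k where "n = Suc k" by (cases n) auto
  then show ?case using imp_trans[OF eq_sym_tm S_neq_Zero] by simp
next
  case (Suc m)
  show ?case
  proof (cases n)
    case 0
    then show ?thesis using S_neq_Zero by simp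
  next
    case (Suc k)
    then show ?thesis using Suc.IH[of k] Suc.prems imp_trans[OF S_inject] by simp
  qed
qed

lemma A_num_iff: "T \<turnstile>\<^sub>Q\<^sub>S\<^sub>L\<^sub>w A (num m) (num n) t \<^bold>\<leftrightarrow> num (m + n) \<^bold>= t"
proof (induction n arbitrary: t)
  case 0
  show ?case using A_Zero by simp
next
  case (Suc n)
  let ?k = "num (m + n)"
  have "T \<turnstile>\<^sub>Q\<^sub>S\<^sub>L\<^sub>w ?k \<^bold>= U \<^bold>\<rightarrow> (X \<^bold>= S U \<^bold>\<rightarrow> S ?k \<^bold>= X)"
    using eq_replace_thm[of T 4 ?k "X \<^bold>= S (Var 4) \<^bold>\<rightarrow> S ?k \<^bold>= X" U] eq_sym_tm by simp
  from conj_decidable_imp[OF eq_decidable conjD1[OF Suc.IH] this]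
  have 1: "T \<turnstile>\<^sub>Q\<^sub>S\<^sub>L\<^sub>w A (num m) (S (num n)) X \<^bold>\<rightarrow> S ?k \<^bold>= X"
    by (intro A_S_elim) auto
  have "T \<turnstile>\<^sub>Q\<^sub>S\<^sub>L\<^sub>w A (num m) (num n) ?k"
    by (rule mp[OF eq_refl_tm conjD2[OF Suc.IH]])
  from imp_conjI[OF imp_weaken[OF this] eq_sym_tm]
  have 2: "T \<turnstile>\<^sub>Q\<^sub>S\<^sub>L\<^sub>w S ?k \<^bold>= X \<^bold>\<rightarrow> A (num m) (S (num n)) X"
    by (rule imp_trans[OF _ A_S_intro]) auto
  from derivable_subst[OF adj[OF 1 2], of t 0] show ?case by simp
qed

lemma M_S_num_imp:
  assumes IH: "\<And>t. T \<turnstile>\<^sub>Q\<^sub>S\<^sub>L\<^sub>w M (num m) (num n) t \<^bold>\<rightarrow> num (m * n) \<^bold>= t"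
    and "3 \<notin> tvars c"
  shows "T \<turnstile>\<^sub>Q\<^sub>S\<^sub>L\<^sub>w M (num m) (S (num n)) c \<^bold>\<rightarrow> num (m * n + m) \<^bold>= c"
proof -
  let ?k = "num (m * n)"
  obtain v where v: "v \<notin> insert 3 (tvars c)" by (rule ex_fresh[of "insert 3 (tvars c)"]) auto
  have "T \<turnstile>\<^sub>Q\<^sub>S\<^sub>L\<^sub>w ?k \<^bold>= U \<^bold>\<rightarrow> (A U (num m) c \<^bold>\<rightarrow> num (m * n + m) \<^bold>= c)"
    using eq_replace_thm[of T v ?k "A (Var v) (num m) c \<^bold>\<rightarrow> num (m * n + m) \<^bold>= c" U]
      conjD1[OF A_num_iff[of "m * n" m c]] v by simp
  from conj_decidable_imp[OF eq_decidable IH this]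
  have "T \<turnstile>\<^sub>Q\<^sub>S\<^sub>L\<^sub>w Ex vu (M (num m) (num n) U \<^bold>\<and> A U (num m) c) \<^bold>\<rightarrow> num (m * n + m) \<^bold>= c"
    by (rule ex_gen) (use assms in auto)
  from imp_trans[OF M_S_num[OF assms(2)] this] show ?thesis .
qed

lemma M_num_iff:
  assumes step: "\<And>m n. T \<turnstile>\<^sub>Q\<^sub>S\<^sub>L\<^sub>w
    M (num m) (num n) U \<^bold>\<rightarrow> (A U (num m) X \<^bold>\<rightarrow> M (num m) (num (n + 1)) X)"
  shows "T \<turnstile>\<^sub>Q\<^sub>S\<^sub>L\<^sub>w M (num m) (num n) t \<^bold>\<leftrightarrow> num (m * n) \<^bold>= t"
proof (induction n arbitrary: t)
  case 0
  show ?case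
    using adj[OF imp_trans[OF conjD1[OF M_Zero] eq_sym_tm] imp_trans[OF eq_sym_tm conjD2[OF M_Zero]]]
    by simp
next
  case (Suc n)
  let ?k = "num (m * n)" and ?l = "num (m * n + m)"
  have 1: "T \<turnstile>\<^sub>Q\<^sub>S\<^sub>L\<^sub>w M (num m) (S (num n)) X \<^bold>\<rightarrow> ?l \<^bold>= X"
    by (rule M_S_num_imp[OF conjD1[OF Suc.IH]]) simp
  have a: "T \<turnstile>\<^sub>Q\<^sub>S\<^sub>L\<^sub>w M (num m) (num n) ?k \<^bold>\<rightarrow> (A ?k (num m) X \<^bold>\<rightarrow> M (num m) (S (num n)) X)"
    using derivable_subst[OF step[of m n], of ?k 3] by simp
  from mp[OF mp[OF eq_refl_tm conjD2[OF Suc.IH]] a]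
  have 2: "T \<turnstile>\<^sub>Q\<^sub>S\<^sub>L\<^sub>w ?l \<^bold>= X \<^bold>\<rightarrow> M (num m) (S (num n)) X"
    by (rule imp_trans[OF conjD2[OF A_num_iff]])
  from derivable_subst[OF adj[OF 1 2], of t 0] show ?case by (simp add: add.commute)
qed

section \<open>The order\<close>

lemma eq_some_upto_intro: "i \<le> n \<Longrightarrow> T \<turnstile>\<^sub>Q\<^sub>S\<^sub>L\<^sub>w t \<^bold>= num i \<^bold>\<rightarrow> eq_some_upto t n"
proof (induction n)
  case 0
  then show ?case using ident by simp
next
  case (Suc n)
  then show ?case using imp_disjI1 disjI2 by (cases "i = Suc n") auto
qed

lemma eq_some_upto_elim:
  "(\<And>i. i \<le> n \<Longrightarrow> T \<turnstile>\<^sub>Q\<^sub>S\<^sub>L\<^sub>w t \<^bold>= num i \<^bold>\<rightarrow> \<chi>) \<Longrightarrow> T \<turnstile>\<^sub>Q\<^sub>S\<^sub>L\<^sub>w eq_some_upto t n \<^bold>\<rightarrow> \<chi>"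
proof (induction n)
  case 0
  from 0[of 0] show ?case by simp
next
  case (Suc n)
  have "T \<turnstile>\<^sub>Q\<^sub>S\<^sub>L\<^sub>w eq_some_upto t n \<^bold>\<rightarrow> \<chi>" by (rule Suc.IH) (use Suc.prems in simp)
  from imp_disjE[OF this Suc.prems[of "Suc n"]] show ?case by simp
qed

lemma fv_eq_some_upto [simp]: "fv (eq_some_upto t n) = tvars t"
  by (induction n) auto

lemma A_num_imp_eq_some_upto: "T \<turnstile>\<^sub>Q\<^sub>S\<^sub>L\<^sub>w A Z X (num n) \<^bold>\<rightarrow> eq_some_upto X n"
proof (induction n)
  have zero: "T \<turnstile>\<^sub>Q\<^sub>S\<^sub>L\<^sub>w A Z Zero (num n) \<^bold>\<rightarrow> eq_some_upto Zero n" for n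
    using imp_weaken[OF mp[OF eq_refl_tm[of T Zero] eq_some_upto_intro[of 0 n Zero, simplified]]] .
  have cases: "T \<turnstile>\<^sub>Q\<^sub>S\<^sub>L\<^sub>w A Z X (num n) \<^bold>\<rightarrow> eq_some_upto X n"
    if "T \<turnstile>\<^sub>Q\<^sub>S\<^sub>L\<^sub>w A Z (S Y) (num n) \<^bold>\<rightarrow> eq_some_upto (S Y) n" for n
    using Zero_S_cases[of "A Z (Var 4) (num n) \<^bold>\<rightarrow> eq_some_upto (Var 4) n" 4 X] zero that by simp
  {
    case 0
    have "T \<turnstile>\<^sub>Q\<^sub>S\<^sub>L\<^sub>w (A Z Y U \<^bold>\<and> Zero \<^bold>= S U) \<^bold>\<rightarrow> eq_some_upto (S Y) 0"
      by (rule imp_trans[OF imp_trans[OF conjE2 imp_trans[OF eq_sym_tm S_neq_Zero]] bot])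
    then show ?case by (intro cases) (simp add: A_S_elim)
  next
    case (Suc n)
    have "T \<turnstile>\<^sub>Q\<^sub>S\<^sub>L\<^sub>w eq_some_upto Y n \<^bold>\<rightarrow> eq_some_upto (S Y) (Suc n)"
    proof (rule eq_some_upto_elim)
      fix i assume "i \<le> n"
      then show "T \<turnstile>\<^sub>Q\<^sub>S\<^sub>L\<^sub>w Y \<^bold>= num i \<^bold>\<rightarrow> eq_some_upto (S Y) (Suc n)"
        using imp_trans[OF eq_S_cong[of T Y "num i"]] eq_some_upto_intro[of "Suc i" "Suc n" "S Y"]
        by simp
    qed
    moreover have "T \<turnstile>\<^sub>Q\<^sub>S\<^sub>L\<^sub>w A Z Y (num n) \<^bold>\<rightarrow> eq_some_upto Y n"
      using derivable_subst[OF Suc.IH, of Y 0] by simp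
    ultimately have "T \<turnstile>\<^sub>Q\<^sub>S\<^sub>L\<^sub>w A Z Y (num n) \<^bold>\<rightarrow> eq_some_upto (S Y) (Suc n)"
      using imp_trans by blast
    then have "T \<turnstile>\<^sub>Q\<^sub>S\<^sub>L\<^sub>w num n \<^bold>= U \<^bold>\<rightarrow> (A Z Y U \<^bold>\<rightarrow> eq_some_upto (S Y) (Suc n))"
      using eq_replace_thm[of T 4 "num n" "A Z Y (Var 4) \<^bold>\<rightarrow> eq_some_upto (S Y) (Suc n)" U] by simp
    from conj_decidable_imp[OF eq_decidable S_inject this]
    have "T \<turnstile>\<^sub>Q\<^sub>S\<^sub>L\<^sub>w (A Z Y U \<^bold>\<and> S (num n) \<^bold>= S U) \<^bold>\<rightarrow> eq_some_upto (S Y) (Suc n)"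
      by (rule imp_trans[OF imp_conjI[OF conjE2 conjE1]])
    then show ?case by (intro cases) (simp add: A_S_elim)
  }
qed

lemma Le_num_iff: "T \<turnstile>\<^sub>Q\<^sub>S\<^sub>L\<^sub>w X \<^bold>\<le> num n \<^bold>\<leftrightarrow> eq_some_upto X n"
proof (rule adj)
  have "T \<turnstile>\<^sub>Q\<^sub>S\<^sub>L\<^sub>w Ex vz (A Z X (num n)) \<^bold>\<rightarrow> eq_some_upto X n"
    by (rule ex_gen[OF A_num_imp_eq_some_upto]) simp
  then show "T \<turnstile>\<^sub>Q\<^sub>S\<^sub>L\<^sub>w X \<^bold>\<le> num n \<^bold>\<rightarrow> eq_some_upto X n"
    by (rule imp_trans[OF conjD1[OF Le_iff], rotated 2]) auto
  show "T \<turnstile>\<^sub>Q\<^sub>S\<^sub>L\<^sub>w eq_some_upto X n \<^bold>\<rightarrow> X \<^bold>\<le> num n"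
  proof (rule eq_some_upto_elim)
    fix i assume "i \<le> n"
    then have "T \<turnstile>\<^sub>Q\<^sub>S\<^sub>L\<^sub>w A (num (n - i)) (num i) (num n)"
      using mp[OF eq_refl_tm[of T "num n"]] conjD2[OF A_num_iff[of "n - i" i "num n"]] by simp
    then have "T \<turnstile>\<^sub>Q\<^sub>S\<^sub>L\<^sub>w num i \<^bold>\<le> num n"
      by (rule mp[OF _ A_imp_Le]) auto
    then show "T \<turnstile>\<^sub>Q\<^sub>S\<^sub>L\<^sub>w X \<^bold>= num i \<^bold>\<rightarrow> X \<^bold>\<le> num n"
      using imp_trans[OF eq_sym_tm eq_replace_thm[of T 4 "num i" "Var 4 \<^bold>\<le> num n" X]] by simp
  qed
qed

lemma Le_num_decidable: "T \<turnstile>\<^sub>Q\<^sub>S\<^sub>L\<^sub>w X \<^bold>\<le> num n \<^bold>\<or> \<^bold>\<not> (X \<^bold>\<le> num n)"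
proof -
  have "T \<turnstile>\<^sub>Q\<^sub>S\<^sub>L\<^sub>w eq_some_upto X n \<^bold>\<or> \<^bold>\<not> eq_some_upto X n"
    by (induction n) (auto intro: eq_decidable decidable_disj)
  from decidable_iff[OF Le_num_iff this] show ?thesis .
qed

lemma A_S_shift: "T \<turnstile>\<^sub>Q\<^sub>S\<^sub>L\<^sub>w A (S Y) (num n) X \<^bold>\<rightarrow> A Y (S (num n)) X"
proof (induction n)
  case 0
  have "T \<turnstile>\<^sub>Q\<^sub>S\<^sub>L\<^sub>w S Y \<^bold>= X \<^bold>\<rightarrow> (A Y Zero Y \<^bold>\<and> X \<^bold>= S Y)"
    by (rule imp_conjI[OF imp_weaken[OF mp[OF eq_refl_tm conjD2[OF A_Zero]]] eq_sym_tm])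
  from imp_trans[OF conjD1[OF A_Zero] imp_trans[OF this A_S_intro]] show ?case by simp
next
  case (Suc n)
  have "T \<turnstile>\<^sub>Q\<^sub>S\<^sub>L\<^sub>w A (S Y) (num n) U \<^bold>\<rightarrow> A Y (S (num n)) U"
    using derivable_subst[OF Suc.IH, of U 0] by simp
  from imp_conjI[OF imp_trans[OF conjE1 this] conjE2]
  have "T \<turnstile>\<^sub>Q\<^sub>S\<^sub>L\<^sub>w (A (S Y) (num n) U \<^bold>\<and> X \<^bold>= S U) \<^bold>\<rightarrow> A Y (S (S (num n))) X"
    by (rule imp_trans[OF _ A_S_intro]) auto
  then show ?case by (simp add: A_S_elim)
qed

lemma Le_num_linear: "T \<turnstile>\<^sub>Q\<^sub>S\<^sub>L\<^sub>w X \<^bold>\<le> num n \<^bold>\<or> num n \<^bold>\<le> X"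
proof (induction n)
  case 0
  have "T \<turnstile>\<^sub>Q\<^sub>S\<^sub>L\<^sub>w Zero \<^bold>\<le> X"
    using mp[OF mp[OF eq_refl_tm conjD2[OF A_Zero]] A_imp_Le] by simp
  then show ?case using mp[OF _ disjI2] by simp
next
  case (Suc n)
  let ?G = "X \<^bold>\<le> num (Suc n) \<^bold>\<or> num (Suc n) \<^bold>\<le> X"
  have mono: "T \<turnstile>\<^sub>Q\<^sub>S\<^sub>L\<^sub>w X \<^bold>\<le> num n \<^bold>\<rightarrow> X \<^bold>\<le> num (Suc n)"
    using imp_trans[OF imp_disjI1[OF conjD1[OF Le_num_iff[of n]]] conjD2[OF Le_num_iff[of "Suc n", simplified]]]
    by simp
  have "T \<turnstile>\<^sub>Q\<^sub>S\<^sub>L\<^sub>w A Zero (num n) X \<^bold>\<rightarrow> num n \<^bold>= X"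
    using conjD1[OF A_num_iff[of 0 n X]] by simp
  moreover have "T \<turnstile>\<^sub>Q\<^sub>S\<^sub>L\<^sub>w num n \<^bold>= X \<^bold>\<rightarrow> X \<^bold>\<le> num n"
    by (rule imp_trans[OF eq_sym_tm imp_trans[OF eq_some_upto_intro conjD2[OF Le_num_iff]]]) simp
  ultimately have zero: "T \<turnstile>\<^sub>Q\<^sub>S\<^sub>L\<^sub>w A Zero (num n) X \<^bold>\<rightarrow> ?G"
    by (rule imp_disjI1[OF imp_trans[OF imp_trans mono]])
  have succ: "T \<turnstile>\<^sub>Q\<^sub>S\<^sub>L\<^sub>w A (S Y) (num n) X \<^bold>\<rightarrow> ?G"
    using imp_disjI2[OF imp_trans[OF A_S_shift A_imp_Le]] by simp
  have "T \<turnstile>\<^sub>Q\<^sub>S\<^sub>L\<^sub>w A Z (num n) X \<^bold>\<rightarrow> ?G"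
    using Zero_S_cases[of "A (Var 4) (num n) X \<^bold>\<rightarrow> ?G" 4 Z] zero succ by simp
  then have "T \<turnstile>\<^sub>Q\<^sub>S\<^sub>L\<^sub>w Ex vz (A Z (num n) X) \<^bold>\<rightarrow> ?G" by (rule ex_gen) simp
  then have "T \<turnstile>\<^sub>Q\<^sub>S\<^sub>L\<^sub>w num n \<^bold>\<le> X \<^bold>\<rightarrow> ?G"
    by (rule imp_trans[OF conjD1[OF Le_iff], rotated 2]) auto
  from disj_cases[OF Suc.IH imp_disjI1[OF mono] this] show ?case .
qed

lemma R_sim_derivable:
  assumes "\<And>m n. T \<turnstile>\<^sub>Q\<^sub>S\<^sub>L\<^sub>w
      M (num m) (num n) U \<^bold>\<rightarrow> (A U (num m) X \<^bold>\<rightarrow> M (num m) (num (n + 1)) X)"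
    and "\<phi> \<in> R_sim"
  shows "T \<turnstile>\<^sub>Q\<^sub>S\<^sub>L\<^sub>w \<phi>"
  using assms(2) unfolding R_sim_def
  by (auto intro: A_num_iff M_num_iff[OF assms(1)] num_neq_num Le_num_iff Le_num_linear
      Le_num_decidable)

lemma M_one_one_zero_refutable: "T \<turnstile>\<^sub>Q\<^sub>S\<^sub>L\<^sub>w \<^bold>\<not> M (num 1) (num 1) Zero"
proof -
  have "T \<turnstile>\<^sub>Q\<^sub>S\<^sub>L\<^sub>w M (num 1) (num 0) t \<^bold>\<rightarrow> num (1 * 0) \<^bold>= t" for t
    using imp_trans[OF conjD1[OF M_Zero] eq_sym_tm] by simp
  from M_S_num_imp[OF this] have "T \<turnstile>\<^sub>Q\<^sub>S\<^sub>L\<^sub>w M (num 1) (S (num 0)) Zero \<^bold>\<rightarrow> S Zero \<^bold>= Zero"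
    by simp
  from imp_trans[OF this S_neq_Zero] show ?thesis by simp
qed

end

lemma Q_sim_printed_inconsistent: "Q_sim_printed \<turnstile>\<^sub>Q\<^sub>S\<^sub>L\<^sub>w \<^bold>\<bottom>"
proof -
  let ?T = Q_sim_printed
  have base: "Q_sim_base \<subseteq> ?T" by (simp add: Q_sim_printed_def)
  have "?T \<turnstile>\<^sub>Q\<^sub>S\<^sub>L\<^sub>w M (num 1) (num 0) U \<^bold>\<rightarrow> (A U (num 0) X \<^bold>\<rightarrow> M (num 1) (num (0 + 1)) X)"
    by (rule hyp) (unfold Q_sim_printed_def, blast)
  from derivable_subst[OF derivable_subst[OF this, of Zero 3], of Zero 0]
  have "?T \<turnstile>\<^sub>Q\<^sub>S\<^sub>L\<^sub>w M (num 1) Zero Zero \<^bold>\<rightarrow> (A Zero Zero Zero \<^bold>\<rightarrow> M (num 1) (num 1) Zero)"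
    by simp
  then have "?T \<turnstile>\<^sub>Q\<^sub>S\<^sub>L\<^sub>w M (num 1) (num 1) Zero"
    using mp[OF eq_refl_tm conjD2[OF M_Zero[OF base]]] mp[OF eq_refl_tm conjD2[OF A_Zero[OF base]]] mp
    by blast
  from mp[OF this M_one_one_zero_refutable[OF base]] show ?thesis .
qed

theorem mainTheorem3:
  shows "(\<forall>\<phi> \<in> R_sim. Q_sim_printed \<turnstile>\<^sub>Q\<^sub>S\<^sub>L\<^sub>w \<phi>) \<and> (\<forall>\<phi> \<in> R_sim. Q_sim \<turnstile>\<^sub>Q\<^sub>S\<^sub>L\<^sub>w \<phi>)"
proof (intro conjI ballI)
  show "Q_sim_printed \<turnstile>\<^sub>Q\<^sub>S\<^sub>L\<^sub>w \<phi>" for \<phi>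
    by (rule mp[OF Q_sim_printed_inconsistent bot])
  show "Q_sim \<turnstile>\<^sub>Q\<^sub>S\<^sub>L\<^sub>w \<phi>" if "\<phi> \<in> R_sim" for \<phi>
  proof (rule R_sim_derivable[OF _ _ that])
    show "Q_sim_base \<subseteq> Q_sim" by (simp add: Q_sim_def)
    show "Q_sim \<turnstile>\<^sub>Q\<^sub>S\<^sub>L\<^sub>w M (num m) (num n) U \<^bold>\<rightarrow> (A U (num m) X \<^bold>\<rightarrow> M (num m) (num (n + 1)) X)" for m n
      by (rule hyp) (unfold Q_sim_def, blast)
  qed
qed

end
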